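(* Let $a\ge2$ be a fixed integer and let $\rho_{n,a}$ be a random permutation with the $a$-shuffle distribution $P_{n,a}$ on $S_n$. Then $$\frac{\mathrm{inv}(\rho_{n,a})-\frac{n(n-1)}{4}\,\frac{a-1}{a}}{\sqrt n\,(n-1)\sqrt{\frac{a^2-1}{36a^2}}}\longrightarrow\mathcal{G}\quad\text{in distribution as }n\to\infty.$$
   Context: $\mathcal{G}$ is a standard normal random variable. For $\sigma\in S_n$, $\mathrm{inv}(\sigma)=\#\{(i,j):1\le i<j\le n,\ \sigma(i)>\sigma(j)\}$. The $a$-shuffle (riffle shuffle) distribution $P_{n,a}$ on $S_n$: cut an $n$-card deck into $a$ piles, with pile sizes $(b_1,\ldots,b_a)$ chosen with multinomial probability $\binom{n}{b_1,\ldots,b_a}a^{-n}$, then choose uniformly one of the $\binom{n}{b_1,\ldots,b_a}$ ways of interleaving the piles, leaving the cards of each pile in their original relative order. Equivalently: assign i.i.d. uniform digits from $\{1,\ldots,a\}$, $X_1,\ldots,X_n$, to the cards $1,\ldots,n$ and sort the cards by digit, preserving the relative order of cards with equal digit; the inverse of the resulting permutation has distribution $P_{n,a}$, so that $\rho_{n,a}(i)=|\{j:X_j<X_i\}|+|\{j\le i:X_j=X_i\}|$. *)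

theory Defs
  imports "HOL-Probability.Probability"
begin

definition inversions :: "nat \<Rightarrow> (nat \<Rightarrow> nat) \<Rightarrow> nat" where
  "inversions n \<sigma> = card {(i, j). 1 \<le> i \<and> i < j \<and> j \<le> n \<and> \<sigma> i > \<sigma> j}"

text \<open>
  A vector of pile sizes is a function supported on \<open>{1..a}\<close>. For \<open>a \<ge> 1\<close> the weights below sum
  to 1, so \<open>embed_pmf\<close> is well-defined; see \<open>pmf_pile_sizes_pmf\<close>.
\<close>

definition pile_sizes :: "nat \<Rightarrow> nat \<Rightarrow> (nat \<Rightarrow> nat) set" where
  "pile_sizes n a = {b. (\<forall>k. k \<notin> {1..a} \<longrightarrow> b k = 0) \<and> (\<Sum>k=1..a. b k) = n}"

definition pile_sizes_pmf :: "nat \<Rightarrow> nat \<Rightarrow> (nat \<Rightarrow> nat) pmf" where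
  "pile_sizes_pmf n a = embed_pmf (\<lambda>b. if b \<in> pile_sizes n a
     then fact n / (\<Prod>k=1..a. fact (b k)) / real a ^ n else 0)"

definition pile :: "(nat \<Rightarrow> nat) \<Rightarrow> nat \<Rightarrow> nat set" where
  "pile b k = {(\<Sum>j=1..<k. b j) <.. (\<Sum>j=1..k. b j)}"

text \<open>
  \<open>\<sigma> i\<close> is the card that ends up in position \<open>i\<close>, so \<open>inv \<sigma> c\<close> is the final position of card \<open>c\<close>.
\<close>

definition interleavings :: "nat \<Rightarrow> nat \<Rightarrow> (nat \<Rightarrow> nat) \<Rightarrow> (nat \<Rightarrow> nat) set" where
  "interleavings n a b =
     {\<sigma>. \<sigma> permutes {1..n} \<and> (\<forall>k\<in>{1..a}. strict_mono_on (pile b k) (inv \<sigma>))}"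

definition riffle_shuffle :: "nat \<Rightarrow> nat \<Rightarrow> (nat \<Rightarrow> nat) pmf" where
  "riffle_shuffle n a =
     bind_pmf (pile_sizes_pmf n a) (\<lambda>b. pmf_of_set (interleavings n a b))"

text \<open>
  The description by i.i.d. uniform digits, which gives the same distribution.
\<close>

definition digit_perm :: "nat \<Rightarrow> (nat \<Rightarrow> nat) \<Rightarrow> nat \<Rightarrow> nat" where
  "digit_perm n x i = (if i \<in> {1..n}
     then card {j\<in>{1..n}. x j < x i} + card {j\<in>{1..i}. x j = x i} else i)"

definition pile_words :: "nat \<Rightarrow> nat \<Rightarrow> (nat \<Rightarrow> nat) \<Rightarrow> (nat \<Rightarrow> nat) set" where
  "pile_words n a b = {x \<in> {1..n} \<rightarrow>\<^sub>E {1..a}. \<forall>k. card {i\<in>{1..n}. x i = k} = b k}"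

lemma card_pile_words:
  assumes b: "b \<in> pile_sizes n a"
  shows "card (pile_words n a b) * (\<Prod>k=1..a. fact (b k)) = fact n"
proof -
  define A where "A = (\<Sum>k\<in>{1..a}. replicate_mset (b k) k)"
  have b0: "b k = 0" if "k \<notin> {1..a}" for k
    using b that by (auto simp: pile_sizes_def)
  have cA: "count A k = b k" for k
    using b0[of k] by (auto simp: A_def count_sum sum.delta')
  have sA: "size A = n"
    using b by (simp add: A_def size_multiset_sum pile_sizes_def)
  have setA: "set_mset A \<subseteq> {1..a}"
    using b0 cA by (metis count_eq_zero_iff subsetI)
  have "bij_betw (\<lambda>x. map x [1..<Suc n]) (pile_words n a b) (permutations_of_multiset A)"
  proof (rule bij_betw_byWitness[where f' = "\<lambda>xs. \<lambda>i\<in>{1..n}. xs ! (i - 1)"])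
    show "\<forall>x\<in>pile_words n a b. (\<lambda>i\<in>{1..n}. map x [1..<Suc n] ! (i - 1)) = x"
      by (auto simp: pile_words_def fun_eq_iff PiE_def extensional_def restrict_def
               simp del: upt_Suc)
    have len: "length xs = n" if "xs \<in> permutations_of_multiset A" for xs
      using that sA by (metis permutations_of_multisetD size_mset)
    show "\<forall>xs\<in>permutations_of_multiset A.
        map (\<lambda>i\<in>{1..n}. xs ! (i - 1)) [1..<Suc n] = xs"
      using len by (auto intro!: nth_equalityI simp del: upt_Suc)
    show "(\<lambda>x. map x [1..<Suc n]) ` pile_words n a b \<subseteq> permutations_of_multiset A"
    proof safe
      fix x assume x: "x \<in> pile_words n a b"
      have "count (mset (map x [1..<Suc n])) k = b k" for k
      proof -
        have "count (mset (map x [1..<Suc n])) k = card {i\<in>{1..n}. x i = k}"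
          by (simp add: count_image_mset vimage_def Int_def conj_commute less_Suc_eq_le
                   del: upt_Suc)
        then show ?thesis using x by (auto simp: pile_words_def)
      qed
      then show "map x [1..<Suc n] \<in> permutations_of_multiset A"
        by (intro permutations_of_multisetI multiset_eqI) (simp only: cA)
    qed
    show "(\<lambda>xs. \<lambda>i\<in>{1..n}. xs ! (i - 1)) ` permutations_of_multiset A \<subseteq> pile_words n a b"
    proof safe
      fix xs assume xs: "xs \<in> permutations_of_multiset A"
      have m: "mset xs = A" using xs by (rule permutations_of_multisetD)
      have "card {i\<in>{1..n}. xs ! (i - 1) = k} = b k" for k
      proof -
        have "b k = count (mset xs) k" by (simp add: m cA)
        also have "\<dots> = length (filter (\<lambda>y. k = y) xs)"
          by (simp add: count_mset count_list_eq_length_filter)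
        also have "\<dots> = card {i. i < n \<and> k = xs ! i}"
          by (simp add: length_filter_conv_card len[OF xs])
        also have "\<dots> = card {i\<in>{1..n}. xs ! (i - 1) = k}"
          by (rule bij_betw_same_card[of Suc])
             (rule bij_betw_byWitness[where f' = "\<lambda>i. i - 1"], auto)
        finally show ?thesis by simp
      qed
      moreover have "xs ! (i - 1) \<in> {1..a}" if "i \<in> {1..n}" for i
        using that len[OF xs] setA m by (metis One_nat_def Suc_pred atLeastAtMost_iff
          less_eq_Suc_le nth_mem set_mset_mset subsetD)
      ultimately show "(\<lambda>i\<in>{1..n}. xs ! (i - 1)) \<in> pile_words n a b"
        by (auto simp: pile_words_def cong: conj_cong)
    qed
  qed
  then have "card (pile_words n a b) = card (permutations_of_multiset A)"
    by (rule bij_betw_same_card)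
  moreover have "(\<Prod>k\<in>set_mset A. fact (count A k) :: nat) = (\<Prod>k=1..a. fact (b k))"
    using setA cA by (intro prod.mono_neutral_cong_left) (auto simp: not_in_iff)
  ultimately show ?thesis
    using card_permutations_of_multiset_aux[of A] sA by (metis of_nat_id)
qed

lemma disjoint_piles:
  assumes "c \<in> pile b k" "c \<in> pile b l" "k \<ge> 1" "l \<ge> 1"
  shows "k = l"
proof -
  have False if "k < l" "c \<in> pile b k" "c \<in> pile b l" for k l
  proof -
    have "(\<Sum>j=1..k. b j) \<le> (\<Sum>j=1..<l. b j)"
      using that(1) by (intro sum_mono2) auto
    then show False using that by (auto simp: pile_def)
  qed
  then show ?thesis using assms by (metis linorder_neqE_nat)
qed

lemma pile_altdef:
  "k \<ge> 1 \<Longrightarrow> pile b k = {(\<Sum>j=1..<k. b j) <.. (\<Sum>j=1..<k. b j) + b k}"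
  by (cases k) (simp_all add: pile_def atLeastLessThanSuc_atLeastAtMost)

lemma card_digit_less:
  assumes "x \<in> pile_words n a b"
  shows "card {j\<in>{1..n}. x j < k} = (\<Sum>l=1..<k. b l)"
proof -
  have "{j\<in>{1..n}. x j < k} = (\<Union>l\<in>{1..<k}. {j\<in>{1..n}. x j = l})"
    using assms by (fastforce simp: pile_words_def)
  also have "card \<dots> = (\<Sum>l=1..<k. card {j\<in>{1..n}. x j = l})"
    by (rule card_UN_disjoint) auto
  finally show ?thesis using assms by (simp add: pile_words_def)
qed

lemma digit_perm_in_pile:
  assumes x: "x \<in> pile_words n a b" and i: "i \<in> {1..n}"
  shows "digit_perm n x i \<in> pile b (x i)"
proof -
  have "x i \<in> {1..a}" using x i by (auto simp: pile_words_def)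
  moreover have "card {j\<in>{1..i}. x j = x i} \<le> card {j\<in>{1..n}. x j = x i}"
    using i by (intro card_mono) auto
  moreover have "card {j\<in>{1..n}. x j = x i} = b (x i)"
    using x by (auto simp: pile_words_def)
  moreover have "card {j\<in>{1..i}. x j = x i} > 0"
    using i by (subst card_gt_0_iff) auto
  ultimately show ?thesis
    using i card_digit_less[OF x, of "x i"] by (simp add: pile_altdef digit_perm_def)
qed

lemma digit_perm_strict_mono:
  assumes "i \<in> {1..n}" "j \<in> {1..n}" "x i = x j" "i < j"
  shows "digit_perm n x i < digit_perm n x j"
proof -
  have "card {l\<in>{1..i}. x l = x i} < card {l\<in>{1..j}. x l = x i}"
  proof (rule psubset_card_mono)
    have "j \<in> {l\<in>{1..j}. x l = x i}" "j \<notin> {l\<in>{1..i}. x l = x i}" using assms by auto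
    moreover have "{l\<in>{1..i}. x l = x i} \<subseteq> {l\<in>{1..j}. x l = x i}" using assms by auto
    ultimately show "{l\<in>{1..i}. x l = x i} \<subset> {l\<in>{1..j}. x l = x i}" by blast
  qed simp
  then show ?thesis using assms by (simp add: digit_perm_def)
qed

lemma pile_subset:
  assumes "b \<in> pile_sizes n a" "k \<in> {1..a}"
  shows "pile b k \<subseteq> {1..n}"
proof -
  have "(\<Sum>j=1..k. b j) \<le> (\<Sum>j=1..a. b j)"
    using assms by (intro sum_mono2) auto
  then show ?thesis using assms by (auto simp: pile_def pile_sizes_def)
qed

lemma in_some_pile:
  assumes b: "b \<in> pile_sizes n a" and c: "c \<in> {1..n}"
  shows "\<exists>k\<in>{1..a}. c \<in> pile b k"
proof -
  define k where "k = (LEAST k. c \<le> (\<Sum>j=1..k. b j))"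
  have ex: "c \<le> (\<Sum>j=1..a. b j)" using b c by (auto simp: pile_sizes_def)
  have k: "c \<le> (\<Sum>j=1..k. b j)" unfolding k_def by (rule LeastI[of _ a]) (rule ex)
  have "k \<le> a" unfolding k_def by (rule Least_le) (rule ex)
  have "k \<noteq> 0"
  proof
    assume "k = 0"
    with k c show False by simp
  qed
  then obtain m where m: "k = Suc m" by (cases k) auto
  have "\<not> c \<le> (\<Sum>j=1..m. b j)"
    using not_less_Least[of m "\<lambda>k. c \<le> (\<Sum>j=1..k. b j)"] m by (simp add: k_def)
  then show ?thesis
    using k \<open>k \<le> a\<close> m
    by (intro bexI[of _ k]) (auto simp: pile_def atLeastLessThanSuc_atLeastAtMost)
qed

lemma digit_perm_interleaving:
  assumes b: "b \<in> pile_sizes n a" and x: "x \<in> pile_words n a b"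
  shows "digit_perm n x \<in> interleavings n a b"
proof -
  let ?f = "digit_perm n x"
  have xa: "x i \<in> {1..a}" if "i \<in> {1..n}" for i using x that by (auto simp: pile_words_def)
  have same: "x i = x j" if "i \<in> {1..n}" "j \<in> {1..n}" "?f i = ?f j" for i j
  proof (rule disjoint_piles)
    show "?f i \<in> pile b (x i)" using digit_perm_in_pile[OF x that(1)] .
    show "?f i \<in> pile b (x j)" using digit_perm_in_pile[OF x that(2)] that(3) by simp
    show "x i \<ge> 1" "x j \<ge> 1" using xa that by auto
  qed
  have inj: "inj_on ?f {1..n}"
    by (rule inj_onI) (metis same digit_perm_strict_mono less_irrefl linorder_neqE_nat)
  have im: "?f ` {1..n} \<subseteq> {1..n}"
    using digit_perm_in_pile[OF x] xa pile_subset[OF b] by blast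
  have perm: "?f permutes {1..n}"
  proof (rule bij_imp_permutes)
    show "bij_betw ?f {1..n} {1..n}"
      using inj im by (simp add: bij_betw_def endo_inj_surj)
  qed (auto simp: digit_perm_def)
  have "inv ?f c < inv ?f d"
    if "k \<in> {1..a}" "c \<in> pile b k" "d \<in> pile b k" "c < d" for k c d
  proof -
    have cd: "c \<in> {1..n}" "d \<in> {1..n}" using pile_subset[OF b that(1)] that by auto
    define i j where "i = inv ?f c" and "j = inv ?f d"
    have ij: "i \<in> {1..n}" "j \<in> {1..n}"
      using cd permutes_in_image[OF permutes_inv[OF perm]] by (auto simp: i_def j_def)
    have fij: "?f i = c" "?f j = d"
      by (auto simp: i_def j_def permutes_inverses[OF perm])
    have "x i = k" "x j = k"
      using disjoint_piles digit_perm_in_pile[OF x] xa ij fij that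
      by (metis atLeastAtMost_iff)+
    then show ?thesis
      using digit_perm_strict_mono[of j n i x] ij fij that
      by (metis i_def j_def less_asym linorder_neqE_nat)
  qed
  then show ?thesis using perm by (auto simp: interleavings_def intro!: strict_mono_onI)
qed

lemma bij_betw_digit_perm:
  assumes b: "b \<in> pile_sizes n a"
  shows "bij_betw (digit_perm n) (pile_words n a b) (interleavings n a b)"
proof (rule bij_betw_imageI)
  show "inj_on (digit_perm n) (pile_words n a b)"
  proof (rule inj_onI)
    fix x y assume x: "x \<in> pile_words n a b" and y: "y \<in> pile_words n a b"
      and eq: "digit_perm n x = digit_perm n y"
    have "x i = y i" if "i \<in> {1..n}" for i
    proof (rule disjoint_piles)
      show "digit_perm n x i \<in> pile b (x i)" using digit_perm_in_pile[OF x that] .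
      show "digit_perm n x i \<in> pile b (y i)" using digit_perm_in_pile[OF y that] eq by simp
      show "x i \<ge> 1" "y i \<ge> 1" using x y that by (auto simp: pile_words_def)
    qed
    moreover have "x \<in> {1..n} \<rightarrow>\<^sub>E {1..a}" "y \<in> {1..n} \<rightarrow>\<^sub>E {1..a}"
      using x y by (simp_all add: pile_words_def)
    ultimately show "x = y" by (metis PiE_ext)
  qed
  show "digit_perm n ` pile_words n a b = interleavings n a b"
  proof (intro equalityI subsetI)
    fix s assume "s \<in> digit_perm n ` pile_words n a b"
    then show "s \<in> interleavings n a b" using digit_perm_interleaving[OF b] by auto
  next
    fix s assume s: "s \<in> interleavings n a b"
    have perm: "s permutes {1..n}" using s by (simp add: interleavings_def)
    have s_in: "s i \<in> {1..n}" if "i \<in> {1..n}" for i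
      using permutes_in_image[OF perm] that by blast
    define x where "x = (\<lambda>i\<in>{1..n}. SOME k. k \<in> {1..a} \<and> s i \<in> pile b k)"
    have x: "x i \<in> {1..a} \<and> s i \<in> pile b (x i)" if "i \<in> {1..n}" for i
    proof -
      have "\<exists>k. k \<in> {1..a} \<and> s i \<in> pile b k" using in_some_pile[OF b s_in[OF that]] by blast
      from someI_ex[OF this] show ?thesis using that by (simp only: x_def restrict_apply if_True)
    qed
    have x_iff: "x i = k \<longleftrightarrow> s i \<in> pile b k" if "i \<in> {1..n}" "k \<in> {1..a}" for i k
      using x[OF that(1)] disjoint_piles[of "s i" b "x i" k] that by auto
    have cnt: "card {i\<in>{1..n}. x i = k} = b k" for k
    proof (cases "k \<in> {1..a}")
      case True
      have "s ` {i\<in>{1..n}. x i = k} = pile b k"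
      proof (intro equalityI subsetI)
        fix c assume c: "c \<in> pile b k"
        then have "c \<in> {1..n}" using pile_subset[OF b True] by auto
        then have "c \<in> s ` {1..n}" using permutes_image[OF perm] by simp
        then show "c \<in> s ` {i\<in>{1..n}. x i = k}" using x_iff True c by auto
      qed (use x in auto)
      moreover have "inj_on s {i\<in>{1..n}. x i = k}"
        using permutes_inj[OF perm] by (rule inj_on_subset) auto
      ultimately have "card {i\<in>{1..n}. x i = k} = card (pile b k)"
        by (metis card_image)
      then show ?thesis using True by (simp add: pile_altdef)
    next
      case False
      have "{i\<in>{1..n}. x i = k} = {}" using x False by auto
      then show ?thesis using b False by (auto simp: pile_sizes_def)
    qed
    have xw: "x \<in> pile_words n a b"
      using x cnt unfolding pile_words_def by (auto simp: x_def)
    have "digit_perm n x i = s i" for i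
    proof (cases "i \<in> {1..n}")
      case False
      then show ?thesis using permutes_not_in[OF perm, of i] by (auto simp: digit_perm_def)
    next
      case True
      let ?k = "x i" and ?B = "\<Sum>j=1..<x i. b j"
      have k: "?k \<in> {1..a}" and si: "s i \<in> pile b ?k" using x[OF True] by auto
      have mono: "strict_mono_on (pile b ?k) (inv s)"
        using s k by (auto simp: interleavings_def)
      have "s ` {j\<in>{1..i}. x j = ?k} = {?B <.. s i}"
      proof (intro equalityI subsetI)
        fix c assume "c \<in> s ` {j\<in>{1..i}. x j = ?k}"
        then obtain j where j: "j \<in> {1..i}" "x j = ?k" "c = s j" by auto
        then have c: "c \<in> pile b ?k" using x[of j] True by auto
        have "\<not> s i < c"
          using strict_mono_onD[OF mono si c] j permutes_inverses[OF perm] by auto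
        then show "c \<in> {?B <.. s i}" using c by (auto simp: pile_def)
      next
        fix c assume c: "c \<in> {?B <.. s i}"
        then have cp: "c \<in> pile b ?k" using si by (auto simp: pile_def)
        then have cn: "c \<in> {1..n}" using pile_subset[OF b k] by auto
        define j where "j = inv s c"
        have j: "j \<in> {1..n}" "s j = c"
          using cn permutes_in_image[OF permutes_inv[OF perm]] permutes_inverses[OF perm]
          by (auto simp: j_def)
        have "j \<le> i"
        proof (cases "c = s i")
          case True
          then show ?thesis using permutes_inverses[OF perm] by (auto simp: j_def)
        next
          case False
          then show ?thesis
            using strict_mono_onD[OF mono cp si] c permutes_inverses[OF perm]
            by (auto simp: j_def)
        qed
        moreover have "x j = ?k" using x_iff[OF j(1) k] j cp by simp
        ultimately show "c \<in> s ` {j\<in>{1..i}. x j = ?k}" using j by auto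
      qed
      moreover have "inj_on s {j\<in>{1..i}. x j = ?k}"
        using permutes_inj[OF perm] by (rule inj_on_subset) auto
      ultimately have "card {j\<in>{1..i}. x j = ?k} = s i - ?B"
        by (metis card_image card_greaterThanAtMost)
      then show ?thesis
        using True si card_digit_less[OF xw, of "x i"] by (simp add: digit_perm_def pile_def)
    qed
    then have "s = digit_perm n x" by auto
    then show "s \<in> digit_perm n ` pile_words n a b" using xw by blast
  qed
qed

lemma card_interleavings:
  assumes "b \<in> pile_sizes n a"
  shows "card (interleavings n a b) * (\<Prod>k=1..a. fact (b k)) = fact n"
  using card_pile_words[OF assms] bij_betw_same_card[OF bij_betw_digit_perm[OF assms]] by simp

context
  fixes n a :: nat
  assumes a: "a \<ge> 1"
begin

private definition W :: "(nat \<Rightarrow> nat) set" where "W = {1..n} \<rightarrow>\<^sub>E {1..a}"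

private definition content :: "(nat \<Rightarrow> nat) \<Rightarrow> nat \<Rightarrow> nat" where
  "content x k = card {i\<in>{1..n}. x i = k}"

private lemma W: "finite W" "W \<noteq> {}" "card W = a ^ n"
  using a by (auto simp: W_def card_PiE PiE_eq_empty_iff intro!: finite_PiE)

private lemma pile_words_W: "pile_words n a b = {x\<in>W. content x = b}"
  by (auto simp: pile_words_def W_def content_def fun_eq_iff)

private lemma content_pile_sizes: "x \<in> W \<Longrightarrow> content x \<in> pile_sizes n a"
proof -
  assume x: "x \<in> W"
  have "(\<Sum>k=1..a. content x k) = card (\<Union>k\<in>{1..a}. {i\<in>{1..n}. x i = k})"
    unfolding content_def by (rule card_UN_disjoint[symmetric]) auto
  also have "(\<Union>k\<in>{1..a}. {i\<in>{1..n}. x i = k}) = {1..n}"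
    using x by (auto simp: W_def)
  finally have 1: "(\<Sum>k=1..a. content x k) = n" by simp
  have 2: "content x k = 0" if "k \<notin> {1..a}" for k
  proof -
    have "{i\<in>{1..n}. x i = k} = {}" using x that by (auto simp: W_def)
    then show ?thesis by (simp add: content_def)
  qed
  show "content x \<in> pile_sizes n a" using 1 2 by (simp add: pile_sizes_def)
qed

private lemma pmf_content:
  "pmf (map_pmf content (pmf_of_set W)) b = (if b \<in> pile_sizes n a
     then fact n / (\<Prod>k=1..a. fact (b k)) / real a ^ n else 0)"
proof -
  have "pmf (map_pmf content (pmf_of_set W)) b = real (card (pile_words n a b)) / real a ^ n"
    using W by (auto simp: pmf_map measure_pmf_of_set pile_words_W vimage_def Int_def)
  also have "\<dots> = (if b \<in> pile_sizes n a
     then fact n / (\<Prod>k=1..a. fact (b k)) / real a ^ n else 0)"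
  proof (cases "b \<in> pile_sizes n a")
    case True
    have "real (card (pile_words n a b)) * (\<Prod>k=1..a. fact (b k)) = fact n"
      using arg_cong[OF card_pile_words[OF True], of real] by simp
    moreover have "(\<Prod>k=1..a. fact (b k) :: real) \<noteq> 0" by simp
    ultimately have "real (card (pile_words n a b)) = fact n / (\<Prod>k=1..a. fact (b k))"
      by (metis nonzero_mult_div_cancel_right)
    then show ?thesis using True by simp
  next
    case False
    then have "pile_words n a b = {}" using content_pile_sizes by (auto simp: pile_words_W)
    then show ?thesis using False by simp
  qed
  finally show ?thesis .
qed

lemma pile_sizes_pmf_content:
  "pile_sizes_pmf n a = map_pmf (\<lambda>x k. card {i\<in>{1..n}. x i = k})
     (pmf_of_set ({1..n} \<rightarrow>\<^sub>E {1..a}))"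
proof -
  have "pile_sizes_pmf n a = embed_pmf (pmf (map_pmf content (pmf_of_set W)))"
    unfolding pile_sizes_pmf_def by (rule arg_cong[of _ _ embed_pmf]) (simp add: pmf_content fun_eq_iff)
  also have "\<dots> = map_pmf content (pmf_of_set W)"
    by (rule type_definition.Rep_inverse[OF td_pmf_embed_pmf])
  finally show ?thesis by (simp add: W_def content_def[abs_def])
qed

lemma pmf_pile_sizes_pmf:
  "pmf (pile_sizes_pmf n a) b = (if b \<in> pile_sizes n a
     then fact n / (\<Prod>k=1..a. fact (b k)) / real a ^ n else 0)"
  using pmf_content[of b]
  by (simp add: pile_sizes_pmf_content W_def content_def[abs_def])

theorem riffle_shuffle_digits:
  "riffle_shuffle n a = map_pmf (digit_perm n) (pmf_of_set ({1..n} \<rightarrow>\<^sub>E {1..a}))"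
proof -
  let ?p = "pmf_of_set W" and ?q = "map_pmf content (pmf_of_set W)"
  have q: "pile_sizes_pmf n a = ?q"
    by (simp add: pile_sizes_pmf_content W_def content_def[abs_def])
  have "riffle_shuffle n a =
      bind_pmf ?q (\<lambda>b. map_pmf (digit_perm n) (cond_pmf ?p {x. b = content x}))"
    unfolding riffle_shuffle_def q
  proof (rule bind_pmf_cong[OF refl])
    fix b assume "b \<in> set_pmf ?q"
    then obtain x where x: "x \<in> W" "b = content x" using W by auto
    have b: "b \<in> pile_sizes n a" using content_pile_sizes x by auto
    have ne: "pile_words n a b \<noteq> {}" and fin: "finite (pile_words n a b)"
      using x W by (auto simp: pile_words_W)
    have ne': "set_pmf ?p \<inter> {x. b = content x} \<noteq> {}" using x W by auto
    have "cond_pmf ?p {x. b = content x} = pmf_of_set (pile_words n a b)"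
    proof (rule pmf_eqI)
      fix y
      have "W \<inter> {x. b = content x} = pile_words n a b" by (auto simp: pile_words_W)
      moreover have "card (pile_words n a b) \<noteq> 0" "card W \<noteq> 0" using ne fin W a by auto
      ultimately show "pmf (cond_pmf ?p {x. b = content x}) y =
          pmf (pmf_of_set (pile_words n a b)) y"
        using W(1,2) ne fin
        by (auto simp: pmf_cond[OF ne'] measure_pmf_of_set pile_words_W indicator_def)
    qed
    then show "pmf_of_set (interleavings n a b) =
        map_pmf (digit_perm n) (cond_pmf ?p {x. b = content x})"
      using bij_betw_digit_perm[OF b] ne fin
      by (simp add: bij_betw_def map_pmf_of_set_inj)
  qed
  also have "\<dots> = map_pmf (digit_perm n) (bind_pmf ?q (\<lambda>b. cond_pmf ?p {x. b = content x}))"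
    by (simp add: map_bind_pmf)
  also have "bind_pmf ?q (\<lambda>b. cond_pmf ?p {x. b = content x}) = ?p"
  proof (rule bind_cond_pmf_cancel)
    fix b x assume "b = content x"
    then show "measure ?p {x. b = content x} = measure ?q {b. b = content x}"
      by (auto simp: vimage_def intro!: arg_cong[of _ _ "measure ?p"])
  qed (use W in auto)
  finally show ?thesis by (simp add: W_def)
qed

end

end

theory Submission
  imports Defs "HOL-Real_Asymp.Real_Asymp"
begin

text \<open>
  The shuffle is the permutation that sorts a uniform random word
  \<open>X\<^sub>1, \<dots>, X\<^sub>n\<close> over \<open>{1..a}\<close> stably, so a pair \<open>i < j\<close> is inverted exactly if \<open>X\<^sub>i > X\<^sub>j\<close>
  (lemma \<open>digit_perm_inversion_iff\<close>). The number of inversions thus is a sum, over pairs, of a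
  function of two independent digits, and Hoeffding's projection method applies to it.

  Conditioning the indicator of \<open>X\<^sub>i > X\<^sub>j\<close> on one digit at a time and subtracting its mean
  \<open>(a - 1) / (2 a)\<close> gives \<open>g X\<^sub>i\<close> and \<open>- g X\<^sub>j\<close>, where \<open>g k = (2 k - 1 - a) / (2 a)\<close>. What is left of
  the indicator is a remainder with conditional mean 0 given either digit. In the sum over all
  pairs, the digit at \<open>i\<close> occurs in first place \<open>n - i\<close> times and in second place \<open>i - 1\<close> times,
  so that
  the centred number of inversions is \<open>\<Sum>\<^sub>i (n + 1 - 2 i) g X\<^sub>i\<close> plus the sum of the remainders
  (lemma \<open>inversions_decomposition\<close>).

  Remainders of distinct pairs are orthogonal, because one of the pairs has an index that the other
  lacks. The sum of the remainders is therefore of order \<open>n\<close> in mean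
  (lemma \<open>sum_abs_remainder_le\<close>), which is negligible against the normalisation of order
  \<open>n\<^bsup>3/2\<^esup>\<close>.

  The linear part has independent centred summands that are uniformly small after normalisation.
  Its characteristic function is a product over the positions, each factor of which is
  Gaussian up to a third-order error (lemma \<open>norm_char_linear_part_le\<close>). Its variance is
  \<open>n (n\<^sup>2 - 1) / 3\<close> times the variance \<open>(a\<^sup>2 - 1) / (12 a\<^sup>2)\<close> of \<open>g X\<^sub>i\<close>, which is asymptotic to the
  square \<open>n (n - 1)\<^sup>2 (a\<^sup>2 - 1) / (36 a\<^sup>2)\<close> of the normalisation. Levy's continuity theorem then gives
  convergence in distribution.

  Since the words are uniformly distributed over a finite set, all expectations are written as
  finite sums over words.
\<close>

section \<open>Inversions of a digit permutation\<close>

abbreviation words :: "nat \<Rightarrow> nat \<Rightarrow> (nat \<Rightarrow> nat) set" where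
  "words n a \<equiv> {1..n} \<rightarrow>\<^sub>E {1..a}"

definition index_pairs :: "nat \<Rightarrow> (nat \<times> nat) set" where
  "index_pairs n = (SIGMA i:{1..n}. {i<..n})"

lemma finite_index_pairs [simp]: "finite (index_pairs n)"
  by (simp add: index_pairs_def)

lemma sum_index_pairs:
  "(\<Sum>(i, j)\<in>index_pairs n. f i j) = (\<Sum>i=1..n. \<Sum>j\<in>{i<..n}. f i j)"
  unfolding index_pairs_def by (rule sum.Sigma[symmetric]) auto

text \<open>
  The digit permutation puts everything with a smaller digit first. Cards up to \<open>i\<close> with the digit
  of \<open>i\<close>, and all cards with smaller digits, have digits below that of \<open>j\<close>; they are counted in the
  position of \<open>j\<close>, which counts \<open>j\<close> itself in addition.
\<close>

lemma digit_perm_less: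
  assumes "i \<in> {1..n}" "j \<in> {1..n}" "x i < x j"
  shows "digit_perm n x i < digit_perm n x j"
proof -
  have "card {l\<in>{1..n}. x l < x i} + card {l\<in>{1..i}. x l = x i}
      = card ({l\<in>{1..n}. x l < x i} \<union> {l\<in>{1..i}. x l = x i})"
    by (rule card_Un_disjoint[symmetric]) auto
  also have "\<dots> \<le> card {l\<in>{1..n}. x l < x j}"
    using assms by (intro card_mono) auto
  also have "\<dots> < card {l\<in>{1..n}. x l < x j} + card {l\<in>{1..j}. x l = x j}"
  proof -
    have "j \<in> {l\<in>{1..j}. x l = x j}" using assms by auto
    then have "card {l\<in>{1..j}. x l = x j} > 0" by (subst card_gt_0_iff) auto
    then show ?thesis by simp
  qed
  finally show ?thesis using assms by (simp add: digit_perm_def)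
qed

text \<open>
  Sorting by digit is stable, so equal digits produce no inversion and unequal ones produce an
  inversion exactly if they are in the wrong order.
\<close>

lemma digit_perm_inversion_iff:
  assumes "1 \<le> i" "i < j" "j \<le> n"
  shows "digit_perm n x i > digit_perm n x j \<longleftrightarrow> x i > x j"
proof (cases "x i" "x j" rule: linorder_cases)
  case less
  then show ?thesis using assms digit_perm_less[of i n j x] by auto
next
  case equal
  then show ?thesis using assms digit_perm_strict_mono[of i n j x] by auto
next
  case greater
  then show ?thesis using assms digit_perm_less[of j n i x] by auto
qed

lemma inversions_digit_perm:
  "real (inversions n (digit_perm n x)) = (\<Sum>(i, j)\<in>index_pairs n. of_bool (x i > x j))"
proof -
  have "{(i, j). 1 \<le> i \<and> i < j \<and> j \<le> n \<and> digit_perm n x i > digit_perm n x j}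
      = index_pairs n \<inter> {(i, j). x i > x j}"
    using digit_perm_inversion_iff by (auto simp: index_pairs_def)
  then show ?thesis
    by (simp add: inversions_def of_bool_def case_prod_unfold sum.If_cases)
qed

section \<open>The projection on single digits\<close>

text \<open>
  For a uniform digit \<open>Y\<close>, this is the probability \<open>(k - 1) / a\<close> of \<open>k > Y\<close> minus the
  probability \<open>(a - 1) / (2 a)\<close> that the first of two independent digits exceeds the second.
  It is also minus the corresponding quantity for \<open>Y > k\<close>, so the same function serves both places
  of a pair.
\<close>

definition centred_digit :: "nat \<Rightarrow> nat \<Rightarrow> real" where
  "centred_digit a k = (2 * real k - 1 - real a) / (2 * real a)"

text \<open>
  The degenerate part in the Hoeffding decomposition of the indicator of \<open>k > l\<close>.
\<close>

definition remainder_kernel :: "nat \<Rightarrow> nat \<Rightarrow> nat \<Rightarrow> real" where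
  "remainder_kernel a k l =
     of_bool (k > l) - (real a - 1) / (2 * real a) - (centred_digit a k - centred_digit a l)"

lemma sum_centred_digit: "(\<Sum>k=1..a. centred_digit a k) = 0"
proof -
  have "(\<Sum>k=1..m. 2 * real k - 1 - c) = real m * (real m - c)" for m c
    by (induction m) (auto simp: algebra_simps)
  from this[of "real a" a] show ?thesis
    by (simp add: centred_digit_def flip: sum_divide_distrib)
qed

text \<open>
  The variance of a centred digit, obtained from the closed form of the sum with the upper limit
  and the centre decoupled, as induction requires.
\<close>

lemma sum_centred_digit_sq:
  assumes "a \<ge> 1"
  shows "(\<Sum>k=1..a. (centred_digit a k)\<^sup>2) / a = ((real a)\<^sup>2 - 1) / (12 * (real a)\<^sup>2)"
proof -
  have *: "(\<Sum>k=1..m. (2 * real k - 1 - c)\<^sup>2)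
      = real m * (4 * (real m)\<^sup>2 - 1) / 3 - 2 * c * (real m)\<^sup>2 + real m * c\<^sup>2" for m c
    by (induction m) (auto simp: field_simps power2_eq_square)
  have "(\<Sum>k=1..a. (centred_digit a k)\<^sup>2) = (\<Sum>k=1..a. (2 * real k - 1 - real a)\<^sup>2) / (2 * real a)\<^sup>2"
    by (simp add: centred_digit_def power_divide flip: sum_divide_distrib)
  also have "\<dots> = (real a * (4 * (real a)\<^sup>2 - 1) / 3 - real a * (real a)\<^sup>2) / (2 * real a)\<^sup>2"
    unfolding * by (simp add: power2_eq_square algebra_simps)
  also have "\<dots> = real a * (((real a)\<^sup>2 - 1) / (12 * (real a)\<^sup>2))"
    by (simp add: field_simps power2_eq_square)
  finally show ?thesis using assms by simp
qed

lemma abs_centred_digit_le: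
  assumes "k \<in> {1..a}"
  shows "\<bar>centred_digit a k\<bar> \<le> 1 / 2"
  using assms by (auto simp: centred_digit_def abs_le_iff divide_le_eq le_divide_eq)

text \<open>
  This and the next lemma are the degeneracy of the kernel: averaging over either digit gives 0,
  because the centred digits are the conditional expectations of the centred indicator.
\<close>

lemma sum_remainder_kernel_left:
  assumes "l \<in> {1..a}"
  shows "(\<Sum>k=1..a. remainder_kernel a k l) = 0"
proof -
  have "{1..a} \<inter> {k. l < k} = {l<..a}" using assms by auto
  then have "(\<Sum>k=1..a. of_bool (k > l) :: real) = real a - real l"
    using assms by (simp add: of_bool_def sum.If_cases of_nat_diff)
  then have "(\<Sum>k=1..a. remainder_kernel a k l)
      = real a - real l - real a * ((real a - 1) / (2 * real a)) + real a * centred_digit a l"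
    using sum_centred_digit[of a] by (simp add: remainder_kernel_def sum_subtractf)
  also have "\<dots> = 0"
    using assms by (simp add: centred_digit_def field_simps)
  finally show ?thesis .
qed

lemma sum_remainder_kernel_right:
  assumes "k \<in> {1..a}"
  shows "(\<Sum>l=1..a. remainder_kernel a k l) = 0"
proof -
  have "{1..a} \<inter> {l. l < k} = {1..<k}" using assms by auto
  then have "(\<Sum>l=1..a. of_bool (k > l) :: real) = real k - 1"
    using assms by (simp add: of_bool_def sum.If_cases of_nat_diff)
  then have "(\<Sum>l=1..a. remainder_kernel a k l)
      = real k - 1 - real a * ((real a - 1) / (2 * real a)) - real a * centred_digit a k"
    using sum_centred_digit[of a] by (simp add: remainder_kernel_def sum_subtractf)
  also have "\<dots> = 0"
    using assms by (simp add: centred_digit_def field_simps)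
  finally show ?thesis .
qed

lemma abs_remainder_kernel_le:
  assumes "k \<in> {1..a}" "l \<in> {1..a}"
  shows "\<bar>remainder_kernel a k l\<bar> \<le> 2"
proof -
  have "0 \<le> (real a - 1) / (2 * real a)" "(real a - 1) / (2 * real a) \<le> 1"
    using assms by (auto simp: field_simps)
  then have "\<bar>of_bool (k > l) - (real a - 1) / (2 * real a)\<bar> \<le> 1"
    by (simp add: of_bool_def abs_le_iff)
  then show ?thesis
    using abs_centred_digit_le[OF assms(1)] abs_centred_digit_le[OF assms(2)]
    unfolding remainder_kernel_def by linarith
qed

definition remainder :: "nat \<Rightarrow> nat \<Rightarrow> (nat \<Rightarrow> nat) \<Rightarrow> real" where
  "remainder a n x = (\<Sum>(i, j)\<in>index_pairs n. remainder_kernel a (x i) (x j))"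

text \<open>
  An index \<open>i\<close> is the smaller one in \<open>n - i\<close> pairs and the larger one in \<open>i - 1\<close> pairs, and
  \<open>(n - i) - (i - 1) = n + 1 - 2 i\<close>.
\<close>

lemma sum_index_pairs_diff:
  fixes g :: "nat \<Rightarrow> real"
  shows "(\<Sum>(i, j)\<in>index_pairs n. g i - g j) = (\<Sum>i=1..n. (real n + 1 - 2 * real i) * g i)"
proof -
  have "(\<Sum>i=1..n. \<Sum>j\<in>{i<..n}. g j) = (\<Sum>i=1..n. \<Sum>j | j \<in> {1..n} \<and> i < j. g j)"
    by (intro sum.cong) auto
  also have "\<dots> = (\<Sum>j=1..n. \<Sum>i | i \<in> {1..n} \<and> i < j. g j)"
    by (rule sum.swap_restrict) auto
  also have "\<dots> = (\<Sum>j=1..n. (real j - 1) * g j)"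
  proof (intro sum.cong refl)
    fix j assume "j \<in> {1..n}"
    moreover from this have "{i. i \<in> {1..n} \<and> i < j} = {1..<j}" by auto
    ultimately show "(\<Sum>i | i \<in> {1..n} \<and> i < j. g j) = (real j - 1) * g j"
      by (simp add: of_nat_diff)
  qed
  finally have 1: "(\<Sum>i=1..n. \<Sum>j\<in>{i<..n}. g j) = (\<Sum>j=1..n. (real j - 1) * g j)" .
  have 2: "(\<Sum>i=1..n. \<Sum>j\<in>{i<..n}. g i) = (\<Sum>i=1..n. (real n - real i) * g i)"
    by (intro sum.cong) (auto simp: of_nat_diff)
  show ?thesis
    unfolding sum_index_pairs sum_subtractf 1 2
    by (simp add: algebra_simps flip: sum_subtractf)
qed

lemma card_index_pairs: "real (card (index_pairs n)) = real n * (real n - 1) / 2"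
proof -
  have "real (card (index_pairs n)) = (\<Sum>i=1..n. real n - real i)"
    by (simp add: index_pairs_def of_nat_diff)
  also have "\<dots> = real n * (real n - 1) / 2"
  proof -
    have "(\<Sum>i=1..m. c - real i) = real m * c - real m * (real m + 1) / 2" for m c
      by (induction m) (auto simp: field_simps)
    from this[of "real n" n] show ?thesis by (simp add: field_simps)
  qed
  finally show ?thesis .
qed

lemma inversions_decomposition:
  "real (inversions n (digit_perm n x)) - real n * (real n - 1) / 4 * ((real a - 1) / real a)
   = (\<Sum>i=1..n. (real n + 1 - 2 * real i) * centred_digit a (x i)) + remainder a n x"
proof -
  have "remainder a n x
      = (\<Sum>(i, j)\<in>index_pairs n. of_bool (x i > x j))
        - real (card (index_pairs n)) * ((real a - 1) / (2 * real a))
        - (\<Sum>(i, j)\<in>index_pairs n. centred_digit a (x i) - centred_digit a (x j))"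
    unfolding remainder_def remainder_kernel_def case_prod_unfold sum_subtractf by simp
  then show ?thesis
    unfolding inversions_digit_perm sum_index_pairs_diff[of "\<lambda>i. centred_digit a (x i)"]
      card_index_pairs
    by simp
qed

section \<open>The remainder is of lower order\<close>

lemma finite_words [simp]: "finite (words n a)"
  by (intro finite_PiE) auto

lemma words_mem: "x \<in> words n a \<Longrightarrow> i \<in> {1..n} \<Longrightarrow> x i \<in> {1..a}"
  by (rule PiE_mem)

text \<open>
  Independence of the digits in the form used below: a word is a digit at \<open>m\<close> together with a word
  on the other positions, so an average over words can be computed by first averaging over the digit
  at \<open>m\<close>.
\<close>

lemma sum_words_resample_eq_0:
  fixes F :: "(nat \<Rightarrow> nat) \<Rightarrow> real"
  assumes m: "m \<in> {1..n}"
    and 0: "\<And>x. x \<in> words n a \<Longrightarrow> (\<Sum>y=1..a. F (x(m := y))) = 0"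
  shows "(\<Sum>x\<in>words n a. F x) = 0"
proof -
  let ?V = "({1..n} - {m}) \<rightarrow>\<^sub>E {1..a}"
  have W: "words n a = (\<lambda>(y, g). g(m := y)) ` ({1..a} \<times> ?V)"
    using m PiE_insert_eq[of m "{1..n} - {m}" "\<lambda>_. {1..a}"] by (simp add: insert_absorb)
  have inj: "inj_on (\<lambda>(y, g). g(m := y)) ({1..a} \<times> ?V)"
    by (rule inj_combinator) simp
  have "(\<Sum>x\<in>words n a. F x) = (\<Sum>(y, g)\<in>{1..a} \<times> ?V. F (g(m := y)))"
    unfolding W by (subst sum.reindex[OF inj]) (simp add: case_prod_unfold)
  also have "\<dots> = (\<Sum>y=1..a. \<Sum>g\<in>?V. F (g(m := y)))"
    by (rule sum.cartesian_product[symmetric])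
  also have "\<dots> = (\<Sum>g\<in>?V. \<Sum>y=1..a. F (g(m := y)))"
    by (rule sum.swap)
  also have "\<dots> = 0"
  proof (rule sum.neutral, rule ballI)
    fix g assume g: "g \<in> ?V"
    show "(\<Sum>y=1..a. F (g(m := y))) = 0"
    proof (cases "a = 0")
      case False
      then have "g(m := 1) \<in> words n a"
        using W g by force
      from 0[OF this] show ?thesis by simp
    qed simp
  qed
  finally show ?thesis .
qed

text \<open>
  Two distinct increasing pairs differ as sets, hence \<open>i\<close> or \<open>j\<close> does not occur in \<open>(k, l)\<close>.
  Averaging over the digit at that position leaves the second factor unchanged and annihilates the
  first one.
\<close>

lemma remainder_kernel_orthogonal:
  assumes p: "(i, j) \<in> index_pairs n" and q: "(k, l) \<in> index_pairs n" and ne: "(i, j) \<noteq> (k, l)"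
  shows "(\<Sum>x\<in>words n a. remainder_kernel a (x i) (x j) * remainder_kernel a (x k) (x l)) = 0"
proof -
  have ij: "1 \<le> i" "i < j" "j \<le> n" and kl: "1 \<le> k" "k < l" "l \<le> n"
    using p q by (auto simp: index_pairs_def)
  then consider "i \<noteq> k" "i \<noteq> l" | "j \<noteq> k" "j \<noteq> l"
    using ne by force
  then show ?thesis
  proof cases
    case 1
    show ?thesis
    proof (rule sum_words_resample_eq_0)
      show "i \<in> {1..n}" using ij by auto
      fix x assume "x \<in> words n a"
      then have "x j \<in> {1..a}" by (rule words_mem) (use ij in auto)
      from sum_remainder_kernel_left[OF this] 1 ij
      show "(\<Sum>y=1..a. remainder_kernel a ((x(i := y)) i) ((x(i := y)) j) *
          remainder_kernel a ((x(i := y)) k) ((x(i := y)) l)) = 0"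
        by (simp flip: sum_distrib_right)
    qed
  next
    case 2
    show ?thesis
    proof (rule sum_words_resample_eq_0)
      show "j \<in> {1..n}" using ij by auto
      fix x assume "x \<in> words n a"
      then have "x i \<in> {1..a}" by (rule words_mem) (use ij in auto)
      from sum_remainder_kernel_right[OF this] 2 ij
      show "(\<Sum>y=1..a. remainder_kernel a ((x(j := y)) i) ((x(j := y)) j) *
          remainder_kernel a ((x(j := y)) k) ((x(j := y)) l)) = 0"
        by (simp flip: sum_distrib_right)
    qed
  qed
qed

text \<open>
  By orthogonality only the diagonal of the double sum over pairs survives. It consists of at
  most \<open>n\<^sup>2\<close> bounded terms, so the mean square is of order \<open>n\<^sup>2\<close> and not of order \<open>n\<^sup>4\<close>.
\<close>

lemma sum_remainder_sq_le: "(\<Sum>x\<in>words n a. (remainder a n x)\<^sup>2) \<le> 4 * (real n)\<^sup>2 * real (a ^ n)"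
proof -
  let ?r = "\<lambda>p x. remainder_kernel a (x (fst p)) (x (snd p))" and ?P = "index_pairs n"
  have "(\<Sum>x\<in>words n a. (remainder a n x)\<^sup>2) = (\<Sum>x\<in>words n a. \<Sum>p\<in>?P. \<Sum>q\<in>?P. ?r p x * ?r q x)"
    by (simp add: remainder_def power2_eq_square sum_product case_prod_unfold)
  also have "\<dots> = (\<Sum>p\<in>?P. \<Sum>q\<in>?P. \<Sum>x\<in>words n a. ?r p x * ?r q x)"
    by (subst sum.swap, intro sum.cong refl, rule sum.swap)
  also have "\<dots> = (\<Sum>p\<in>?P. \<Sum>q\<in>?P. if q = p then \<Sum>x\<in>words n a. ?r p x * ?r p x else 0)"
  proof (intro sum.cong refl)
    fix p q assume "p \<in> ?P" "q \<in> ?P"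
    then show "(\<Sum>x\<in>words n a. ?r p x * ?r q x)
        = (if q = p then \<Sum>x\<in>words n a. ?r p x * ?r p x else 0)"
      using remainder_kernel_orthogonal[of "fst p" "snd p" n "fst q" "snd q" a]
      by (auto simp: prod_eq_iff)
  qed
  also have "\<dots> = (\<Sum>p\<in>?P. \<Sum>x\<in>words n a. ?r p x * ?r p x)"
    by simp
  also have "\<dots> \<le> (\<Sum>p\<in>?P. \<Sum>x\<in>words n a. 4)"
  proof (intro sum_mono)
    fix p x assume "p \<in> ?P" "x \<in> words n a"
    then have "x (fst p) \<in> {1..a}" "x (snd p) \<in> {1..a}"
      by (auto simp: index_pairs_def intro!: words_mem[of x n a, simplified])
    from abs_remainder_kernel_le[OF this] have "(?r p x)\<^sup>2 \<le> 2\<^sup>2"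
      by (subst abs_le_square_iff[symmetric]) simp
    then show "?r p x * ?r p x \<le> 4" by (simp add: power2_eq_square)
  qed
  also have "\<dots> = 4 * (real n * (real n - 1) / 2) * real (a ^ n)"
    by (simp add: card_PiE card_index_pairs)
  also have "\<dots> \<le> 4 * (real n)\<^sup>2 * real (a ^ n)"
    by (intro mult_right_mono) (auto simp: power2_eq_square algebra_simps)
  finally show ?thesis .
qed

text \<open>
  The first moment follows from the second one by the elementary inequality
  \<open>2 \<bar>r\<bar> n \<le> r\<^sup>2 + n\<^sup>2\<close>, which stands in for the Cauchy-Schwarz inequality.
\<close>

lemma sum_abs_remainder_le: "(\<Sum>x\<in>words n a. \<bar>remainder a n x\<bar>) \<le> 5 / 2 * real n * real (a ^ n)"
proof (cases "n = 0")
  case True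
  then show ?thesis by (simp add: remainder_def index_pairs_def)
next
  case False
  have "\<bar>r\<bar> \<le> (r\<^sup>2 / real n + real n) / 2" for r
  proof -
    have "0 \<le> (\<bar>r\<bar> - real n)\<^sup>2" by simp
    then have "2 * \<bar>r\<bar> * real n \<le> r\<^sup>2 + (real n)\<^sup>2" by (simp add: power2_diff)
    then show ?thesis using False by (simp add: field_simps power2_eq_square)
  qed
  then have "(\<Sum>x\<in>words n a. \<bar>remainder a n x\<bar>)
      \<le> (\<Sum>x\<in>words n a. ((remainder a n x)\<^sup>2 / real n + real n) / 2)"
    by (intro sum_mono)
  also have "\<dots> = ((\<Sum>x\<in>words n a. (remainder a n x)\<^sup>2) / real n + real n * real (a ^ n)) / 2"
    by (simp add: sum.distrib card_PiE flip: sum_divide_distrib)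
  also have "\<dots> \<le> (4 * (real n)\<^sup>2 * real (a ^ n) / real n + real n * real (a ^ n)) / 2"
    by (intro divide_right_mono add_mono sum_remainder_sq_le) auto
  also have "\<dots> = 5 / 2 * real n * real (a ^ n)"
    using False by (simp add: power2_eq_square field_simps)
  finally show ?thesis .
qed

section \<open>Characteristic functions\<close>

lemma norm_iexp_diff_le: "cmod (iexp u - iexp v) \<le> \<bar>u - v\<bar>"
proof -
  have "iexp u - iexp v = iexp v * (iexp (u - v) - 1)"
    by (simp add: algebra_simps flip: exp_add)
  then have "cmod (iexp u - iexp v) = cmod (iexp (u - v) - 1)"
    by (simp add: norm_mult)
  also have "\<dots> \<le> \<bar>u - v\<bar>"
    using iexp_approx1[of "u - v" 0] by simp
  finally show ?thesis .
qed

text \<open>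
  The upper bound comes from \<open>exp (- z) \<le> 1 / (1 + z) \<le> 1 - z + z\<^sup>2\<close>.
\<close>

lemma exp_minus_approx:
  fixes z :: real
  assumes "z \<ge> 0"
  shows "\<bar>exp (- z) - (1 - z)\<bar> \<le> z\<^sup>2"
proof -
  have "exp (- z) \<le> 1 / (1 + z)"
    using assms exp_ge_add_one_self[of z] by (simp add: exp_minus field_simps)
  also have "\<dots> \<le> 1 - z + z\<^sup>2"
    using assms by (simp add: field_simps power2_eq_square)
  finally show ?thesis
    using exp_ge_add_one_self[of "- z"] by (simp add: abs_le_iff)
qed

text \<open>
  The characteristic function of a centred variable, uniform on a finite set, compared with the
  Gaussian of the same variance. Both agree with \<open>1 - u\<^sup>2 v / 2\<close>, up to \<open>\<bar>u\<bar>\<^sup>3 / 6\<close> by Taylor's formula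
  for the former and up to \<open>u\<^sup>4 / 4\<close> for the latter.
\<close>

lemma norm_mean_iexp_minus_gaussian_le:
  fixes g :: "'a \<Rightarrow> real"
  assumes A: "finite A" "A \<noteq> {}"
    and mean: "(\<Sum>k\<in>A. g k) = 0"
    and var: "(\<Sum>k\<in>A. (g k)\<^sup>2) / card A = v"
    and bound: "\<And>k. k \<in> A \<Longrightarrow> \<bar>g k\<bar> \<le> 1"
  shows "cmod ((\<Sum>k\<in>A. iexp (u * g k)) / card A - exp (- (u\<^sup>2 * v / 2))) \<le> \<bar>u\<bar> ^ 3 / 6 + u ^ 4 / 4"
proof -
  define N where "N = real (card A)"
  have N: "N > 0" using A by (simp add: N_def card_gt_0_iff)
  have g2: "(g k)\<^sup>2 \<le> 1" if "k \<in> A" for k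
    using bound[OF that] by (simp add: abs_square_le_1)
  have v: "0 \<le> v" "v \<le> 1"
  proof -
    show "0 \<le> v" unfolding var[symmetric] by (simp add: sum_nonneg)
    have "(\<Sum>k\<in>A. (g k)\<^sup>2) \<le> (\<Sum>k\<in>A. 1)" by (intro sum_mono g2)
    then show "v \<le> 1" using N unfolding var[symmetric] by (simp add: N_def)
  qed
  \<comment> \<open>The linear terms of the Taylor polynomials sum to 0, the quadratic ones to the variance.\<close>
  let ?T = "\<lambda>y. 1 + \<i> * complex_of_real y - complex_of_real (y\<^sup>2 / 2)"
  have T: "cmod (iexp y - ?T y) \<le> \<bar>y\<bar> ^ 3 / 6" for y
  proof -
    have "(\<Sum>k\<le>2. (\<i> * complex_of_real y) ^ k / fact k) = ?T y"
      by (simp add: numeral_2_eq_2 mult_ac)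
    then show ?thesis using iexp_approx1[of y 2] by (simp add: eval_nat_numeral)
  qed
  have sT: "(\<Sum>k\<in>A. ?T (u * g k)) / N = complex_of_real (1 - u\<^sup>2 * v / 2)"
  proof -
    have "(\<Sum>k\<in>A. ?T (u * g k)) = of_real N + \<i> * of_real (u * (\<Sum>k\<in>A. g k))
        - of_real (u\<^sup>2 * (\<Sum>k\<in>A. (g k)\<^sup>2) / 2)"
    proof -
      have "(\<Sum>k\<in>A. \<i> * complex_of_real (u * g k)) = \<i> * of_real (u * (\<Sum>k\<in>A. g k))"
        by (simp only: sum_distrib_left of_real_sum)
      moreover have "(\<Sum>k\<in>A. complex_of_real ((u * g k)\<^sup>2 / 2)) = of_real (u\<^sup>2 * (\<Sum>k\<in>A. (g k)\<^sup>2) / 2)"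
        by (simp only: sum_distrib_left sum_divide_distrib of_real_sum power_mult_distrib)
      ultimately show ?thesis
        unfolding sum.distrib sum_subtractf by (simp add: N_def)
    qed
    also have "(\<Sum>k\<in>A. (g k)\<^sup>2) = v * N"
      using var N by (auto simp: N_def)
    finally show ?thesis using N by (simp add: mean field_simps)
  qed
  have "cmod ((\<Sum>k\<in>A. iexp (u * g k)) / N - of_real (1 - u\<^sup>2 * v / 2))
      = cmod (\<Sum>k\<in>A. iexp (u * g k) - ?T (u * g k)) / N"
    unfolding sT[symmetric] diff_divide_distrib[symmetric] sum_subtractf[symmetric]
    using N by (simp add: norm_divide)
  also have "\<dots> \<le> (\<Sum>k\<in>A. \<bar>u\<bar> ^ 3 / 6) / N"
  proof (intro divide_right_mono order_trans[OF norm_sum] sum_mono)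
    fix k assume k: "k \<in> A"
    have "\<bar>u * g k\<bar> ^ 3 \<le> \<bar>u\<bar> ^ 3"
      using bound[OF k] by (intro power_mono) (auto simp: abs_mult mult_left_le)
    then show "cmod (iexp (u * g k) - ?T (u * g k)) \<le> \<bar>u\<bar> ^ 3 / 6"
      using T[of "u * g k"] by linarith
  qed (use N in simp)
  also have "\<dots> = \<bar>u\<bar> ^ 3 / 6" using N by (simp add: N_def)
  finally have 1: "cmod ((\<Sum>k\<in>A. iexp (u * g k)) / N - of_real (1 - u\<^sup>2 * v / 2)) \<le> \<bar>u\<bar> ^ 3 / 6" .
  have "\<bar>exp (- (u\<^sup>2 * v / 2)) - (1 - u\<^sup>2 * v / 2)\<bar> \<le> (u\<^sup>2 * v / 2)\<^sup>2"
    by (rule exp_minus_approx) (use v in simp)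
  also have "\<dots> \<le> (u\<^sup>2 * 1 / 2)\<^sup>2"
    using v by (intro power_mono divide_right_mono mult_left_mono) auto
  also have "\<dots> = u ^ 4 / 4" by (simp add: power_divide flip: power_mult)
  finally have 2: "cmod (of_real (1 - u\<^sup>2 * v / 2) - of_real (exp (- (u\<^sup>2 * v / 2)))) \<le> u ^ 4 / 4"
    unfolding of_real_diff[symmetric] norm_of_real by (simp add: abs_minus_commute)
  show ?thesis
    using norm_diff_triangle_le[OF 1 2] by (simp add: N_def)
qed

lemma sum_squared_weights: "(\<Sum>i=1..n. (real n + 1 - 2 * real i)\<^sup>2) = real n * ((real n)\<^sup>2 - 1) / 3"
proof -
  have "(\<Sum>i=1..m. (c - 2 * real i)\<^sup>2)
      = real m * c\<^sup>2 - 2 * c * real m * (real m + 1)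
        + 2 * real m * (real m + 1) * (2 * real m + 1) / 3" for m c
    by (induction m) (auto simp: field_simps power2_eq_square)
  from this[of "real n + 1" n] show ?thesis by (simp add: field_simps power2_eq_square)
qed

text \<open>
  Independence turns the characteristic function of the weighted sum into a product over the
  positions. The Gaussian factors as well, and the difference of two products of numbers in the unit
  disc is at most the sum of the differences of their factors. As the weights are at most \<open>n\<close> in
  absolute value, each of these is bounded by the value of the one-digit estimate at \<open>\<bar>u\<bar> n\<close>.
\<close>

lemma norm_char_linear_part_le:
  assumes a: "a \<ge> 1"
  shows "cmod ((\<Sum>x\<in>words n a. iexp (u * (\<Sum>i=1..n. (real n + 1 - 2 * real i) * centred_digit a (x i))))
        / real (a ^ n)
      - exp (- (u\<^sup>2 * (real n * ((real n)\<^sup>2 - 1) / 3) * (((real a)\<^sup>2 - 1) / (12 * (real a)\<^sup>2)) / 2)))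
    \<le> real n * ((\<bar>u\<bar> * real n) ^ 3 / 6 + (\<bar>u\<bar> * real n) ^ 4 / 4)"
proof -
  define v where "v = ((real a)\<^sup>2 - 1) / (12 * (real a)\<^sup>2)"
  define c where "c i = real n + 1 - 2 * real i" for i
  define z where "z i = (\<Sum>k=1..a. iexp ((u * c i) * centred_digit a k)) / card {1..a}" for i
  define w where "w i = complex_of_real (exp (- ((u * c i)\<^sup>2 * v / 2)))" for i
  have v0: "v \<ge> 0" using a by (simp add: v_def)
  have "(\<Sum>x\<in>words n a. iexp (u * (\<Sum>i=1..n. c i * centred_digit a (x i)))) / real (a ^ n)
      = (\<Sum>x\<in>words n a. \<Prod>i=1..n. iexp ((u * c i) * centred_digit a (x i))) / real a ^ n"
    by (simp add: sum_distrib_left exp_sum mult.assoc)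
  also have "(\<Sum>x\<in>words n a. \<Prod>i=1..n. iexp ((u * c i) * centred_digit a (x i)))
      = (\<Prod>i=1..n. \<Sum>k=1..a. iexp ((u * c i) * centred_digit a k))"
    by (rule prod_sum_PiE[symmetric]) auto
  also have "\<dots> / real a ^ n = (\<Prod>i=1..n. z i)"
    by (simp add: z_def prod_dividef)
  finally have z: "(\<Sum>x\<in>words n a. iexp (u * (\<Sum>i=1..n. c i * centred_digit a (x i))))
      / real (a ^ n) = (\<Prod>i=1..n. z i)" .
  have "(\<Prod>i=1..n. w i) = exp (\<Sum>i=1..n. - ((u * c i)\<^sup>2 * v / 2))"
    by (simp add: w_def exp_sum)
  also have "(\<Sum>i=1..n. - ((u * c i)\<^sup>2 * v / 2)) = - (u\<^sup>2 * (\<Sum>i=1..n. (c i)\<^sup>2) * v / 2)"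
    by (simp add: sum_negf sum_distrib_left sum_distrib_right sum_divide_distrib power_mult_distrib)
  finally have w: "(\<Prod>i=1..n. w i) = exp (- (u\<^sup>2 * (real n * ((real n)\<^sup>2 - 1) / 3) * v / 2))"
    unfolding c_def sum_squared_weights by simp
  have "cmod ((\<Prod>i=1..n. z i) - (\<Prod>i=1..n. w i)) \<le> (\<Sum>i=1..n. cmod (z i - w i))"
  proof (rule norm_prod_diff)
    fix i
    have "cmod (\<Sum>k=1..a. iexp ((u * c i) * centred_digit a k)) \<le> (\<Sum>k=1..a. 1)"
      by (rule order_trans[OF norm_sum]) (intro sum_mono, simp)
    then show "cmod (z i) \<le> 1" using a by (simp add: z_def norm_divide)
    show "cmod (w i) \<le> 1" using v0 by (simp add: w_def)
  qed
  also have "\<dots> \<le> (\<Sum>i=1..n. (\<bar>u\<bar> * real n) ^ 3 / 6 + (\<bar>u\<bar> * real n) ^ 4 / 4)"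
  proof (intro sum_mono)
    fix i assume i: "i \<in> {1..n}"
    have "\<bar>centred_digit a k\<bar> \<le> 1" if "k \<in> {1..a}" for k
      using abs_centred_digit_le[OF that] by simp
    then have 1: "cmod (z i - w i) \<le> \<bar>u * c i\<bar> ^ 3 / 6 + (u * c i) ^ 4 / 4"
      unfolding z_def w_def using a sum_centred_digit_sq[OF a]
      by (intro norm_mean_iexp_minus_gaussian_le sum_centred_digit) (auto simp: v_def)
    have "\<bar>c i\<bar> \<le> real n" using i by (auto simp: c_def abs_le_iff)
    then have uc: "\<bar>u * c i\<bar> \<le> \<bar>u\<bar> * real n" by (simp add: abs_mult mult_left_mono)
    have "(u * c i) ^ 4 = \<bar>u * c i\<bar> ^ 4" by (rule power_even_abs[symmetric]) simp
    with 1 power_mono[OF uc, of 3] power_mono[OF uc, of 4]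
    show "cmod (z i - w i) \<le> (\<bar>u\<bar> * real n) ^ 3 / 6 + (\<bar>u\<bar> * real n) ^ 4 / 4"
      by linarith
  qed
  also have "\<dots> = real n * ((\<bar>u\<bar> * real n) ^ 3 / 6 + (\<bar>u\<bar> * real n) ^ 4 / 4)"
    by simp
  finally show ?thesis unfolding z[symmetric] w unfolding c_def v_def by simp
qed


definition standardised_inversions :: "nat \<Rightarrow> nat \<Rightarrow> (nat \<Rightarrow> nat) \<Rightarrow> real" where
  "standardised_inversions n a \<sigma> =
     (real (inversions n \<sigma>) - real n * (real n - 1) / 4 * ((real a - 1) / real a))
       / (sqrt (real n) * (real n - 1) * sqrt (((real a)\<^sup>2 - 1) / (36 * (real a)\<^sup>2)))"

text \<open>
  With \<open>D\<close> the normalisation, the characteristic function differs from that of the linear part by at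
  most \<open>\<bar>t\<bar> / D\<close> times the mean of the absolute remainder, and the linear part is compared with a
  Gaussian whose variance is \<open>(n + 1) / (n - 1)\<close>, the ratio of the variance of the linear part to
  \<open>D\<^sup>2\<close>. As \<open>D\<close> grows like \<open>n\<^bsup>3/2\<^esup>\<close>, both errors are \<open>O(n\<^bsup>-1/2\<^esup>)\<close>.
\<close>

lemma char_standardised_inversions_tendsto:
  fixes t :: real
  assumes a: "a \<ge> 2"
  shows "(\<lambda>n. (\<Sum>x\<in>words n a. iexp (t * standardised_inversions n a (digit_perm n x))) / real (a ^ n))
    \<longlonglongrightarrow> complex_of_real (exp (- (t\<^sup>2) / 2))"
proof -
  define s where "s = sqrt (((real a)\<^sup>2 - 1) / (36 * (real a)\<^sup>2))"
  have "(real a)\<^sup>2 \<ge> 2\<^sup>2" using a by (intro power_mono) auto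
  then have s: "s > 0" using a by (auto simp: s_def)
  have s2: "s\<^sup>2 = ((real a)\<^sup>2 - 1) / (36 * (real a)\<^sup>2)"
    using \<open>(real a)\<^sup>2 \<ge> 2\<^sup>2\<close> by (simp add: s_def)
  define D where "D n = sqrt (real n) * (real n - 1) * s" for n
  define L where "L n x = (\<Sum>i=1..n. (real n + 1 - 2 * real i) * centred_digit a (x i))" for n x
  define \<phi> where "\<phi> n = (\<Sum>x\<in>words n a. iexp (t * ((L n x + remainder a n x) / D n))) / real (a ^ n)" for n
  define \<psi> where "\<psi> n = (\<Sum>x\<in>words n a. iexp ((t / D n) * L n x)) / real (a ^ n)" for n
  define \<gamma> where "\<gamma> n = exp (- (t\<^sup>2 / 2 * ((real n + 1) / (real n - 1))))" for n
  define b where "b n = 5 / 2 * (\<bar>t\<bar> / D n * real n)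
      + real n * ((\<bar>t\<bar> / D n * real n) ^ 3 / 6 + (\<bar>t\<bar> / D n * real n) ^ 4 / 4)" for n
  have bound: "cmod (\<phi> n - of_real (\<gamma> n)) \<le> b n" if n: "n \<ge> 2" for n
  proof -
    have D: "D n > 0" using n s by (simp add: D_def)
    have "\<phi> n - \<psi> n = (\<Sum>x\<in>words n a. iexp (t * ((L n x + remainder a n x) / D n))
        - iexp ((t / D n) * L n x)) / real (a ^ n)"
      by (simp add: \<phi>_def \<psi>_def sum_subtractf diff_divide_distrib)
    then have "cmod (\<phi> n - \<psi> n) = cmod (\<Sum>x\<in>words n a. iexp (t * ((L n x + remainder a n x) / D n))
        - iexp ((t / D n) * L n x)) / real (a ^ n)"
      by (simp add: norm_divide norm_power)
    also have "\<dots> \<le> (\<Sum>x\<in>words n a. \<bar>t\<bar> / D n * \<bar>remainder a n x\<bar>) / real (a ^ n)"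
    proof (intro divide_right_mono order_trans[OF norm_sum] sum_mono)
      fix x
      have "t * ((L n x + remainder a n x) / D n) - (t / D n) * L n x = t / D n * remainder a n x"
        by (simp add: field_simps add_divide_distrib)
      then show "cmod (iexp (t * ((L n x + remainder a n x) / D n)) - iexp ((t / D n) * L n x))
          \<le> \<bar>t\<bar> / D n * \<bar>remainder a n x\<bar>"
        using norm_iexp_diff_le[of "t * ((L n x + remainder a n x) / D n)" "(t / D n) * L n x"] D
        by (simp add: abs_mult)
    qed simp
    also have "\<dots> = \<bar>t\<bar> / D n * ((\<Sum>x\<in>words n a. \<bar>remainder a n x\<bar>) / real (a ^ n))"
      by (simp only: sum_distrib_left[symmetric] times_divide_eq_right)
    also have "\<dots> \<le> \<bar>t\<bar> / D n * (5 / 2 * real n)"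
      using sum_abs_remainder_le[of a n] a D
      by (intro mult_left_mono) (auto simp: divide_le_eq)
    also have "\<dots> = 5 / 2 * (\<bar>t\<bar> / D n * real n)" by simp
    finally have 1: "cmod (\<phi> n - \<psi> n) \<le> 5 / 2 * (\<bar>t\<bar> / D n * real n)" .
    have "(t / D n)\<^sup>2 * (real n * ((real n)\<^sup>2 - 1) / 3) * (((real a)\<^sup>2 - 1) / (12 * (real a)\<^sup>2)) / 2
        = t\<^sup>2 / 2 * ((real n + 1) / (real n - 1))"
    proof -
      \<comment> \<open>Here \<open>T = t\<^sup>2\<close>, \<open>N = n\<close>, \<open>m = n - 1\<close>, \<open>p = n + 1\<close> and \<open>S = s\<^sup>2\<close>.\<close>
      have cancel: "T / (N * m\<^sup>2 * S) * (N * (p * m) / 3) * (3 * S) / 2 = T / 2 * (p / m)"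
        if "N \<noteq> 0" "m \<noteq> 0" "S \<noteq> 0" for T N m p S :: real
        using that by (simp add: divide_simps power2_eq_square)
      have var: "((real a)\<^sup>2 - 1) / (12 * (real a)\<^sup>2) = 3 * s\<^sup>2"
      proof -
        have "x / (12 * y) = 3 * (x / (36 * y))" for x y :: real by simp
        then show ?thesis unfolding s2 .
      qed
      have D2: "(D n)\<^sup>2 = real n * (real n - 1)\<^sup>2 * s\<^sup>2" by (simp add: D_def power_mult_distrib)
      have n2: "(real n)\<^sup>2 - 1 = (real n + 1) * (real n - 1)"
        by (simp add: power2_eq_square algebra_simps)
      show ?thesis
        unfolding power_divide var D2 n2 using n s by (intro cancel) auto
    qed
    then have 2: "cmod (\<psi> n - of_real (\<gamma> n))
        \<le> real n * ((\<bar>t\<bar> / D n * real n) ^ 3 / 6 + (\<bar>t\<bar> / D n * real n) ^ 4 / 4)"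
      using norm_char_linear_part_le[of a "t / D n" n] a D
      unfolding \<psi>_def L_def \<gamma>_def by simp
    show ?thesis unfolding b_def using norm_diff_triangle_le[OF 1 2] .
  qed
  have "b \<longlonglongrightarrow> 0"
  proof -
    \<comment> \<open>Collecting the powers of \<open>\<bar>t\<bar> / s\<close> leaves three parameter-free null sequences.\<close>
    define p where "p n = real n / (sqrt (real n) * (real n - 1))" for n
    have p: "p \<longlonglongrightarrow> 0" "(\<lambda>n. real n * p n ^ 3) \<longlonglongrightarrow> 0" "(\<lambda>n. real n * p n ^ 4) \<longlonglongrightarrow> 0"
      unfolding p_def by real_asymp+
    have q: "\<bar>t\<bar> / D n * real n = \<bar>t\<bar> / s * p n" for n
      by (simp add: D_def p_def)
    have "b n = 5 / 2 * (\<bar>t\<bar> / s * p n)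
        + real n * ((\<bar>t\<bar> / s * p n) ^ 3 / 6 + (\<bar>t\<bar> / s * p n) ^ 4 / 4)" for n
      by (simp only: b_def q)
    then have "b = (\<lambda>n. \<bar>t\<bar> / s * (5 / 2) * p n + (\<bar>t\<bar> / s) ^ 3 / 6 * (real n * p n ^ 3)
        + (\<bar>t\<bar> / s) ^ 4 / 4 * (real n * p n ^ 4))"
      by (simp only: fun_eq_iff power_mult_distrib) (simp add: distrib_left mult_ac)
    then show ?thesis
      using tendsto_add[OF tendsto_add[OF tendsto_mult_left[OF p(1), of "\<bar>t\<bar> / s * (5 / 2)"]
          tendsto_mult_left[OF p(2), of "(\<bar>t\<bar> / s) ^ 3 / 6"]]
          tendsto_mult_left[OF p(3), of "(\<bar>t\<bar> / s) ^ 4 / 4"]] by simp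
  qed
  then have diff: "(\<lambda>n. \<phi> n - of_real (\<gamma> n)) \<longlonglongrightarrow> 0"
  proof (rule Lim_null_comparison[rotated])
    show "\<forall>\<^sub>F n in sequentially. cmod (\<phi> n - of_real (\<gamma> n)) \<le> b n"
      using bound by (rule eventually_sequentiallyI)
  qed
  have "\<gamma> \<longlonglongrightarrow> exp (- (t\<^sup>2 / 2 * 1))"
    unfolding \<gamma>_def by (intro tendsto_intros) real_asymp
  then have "(\<lambda>n. of_real (\<gamma> n)) \<longlonglongrightarrow> complex_of_real (exp (- (t\<^sup>2) / 2))"
    by (intro tendsto_of_real) simp
  from tendsto_add[OF diff this] show ?thesis
    unfolding standardised_inversions_def inversions_decomposition \<phi>_def L_def D_def s_def by simp
qed

section \<open>Convergence in distribution\<close>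

text \<open>
  The characteristic function depends only on the law of the shuffle, which is the image of the
  uniform distribution on words.
\<close>

lemma char_distr_riffle_shuffle:
  fixes f :: "(nat \<Rightarrow> nat) \<Rightarrow> real"
  assumes a: "a \<ge> 1"
    and meas: "\<rho> \<in> measurable M (count_space UNIV)"
    and law: "distr M (count_space UNIV) \<rho> = measure_pmf (riffle_shuffle n a)"
  shows "char (distr M borel (\<lambda>\<omega>. f (\<rho> \<omega>))) t
    = (\<Sum>x\<in>words n a. iexp (t * f (digit_perm n x))) / real (a ^ n)"
proof -
  define W where "W = words n a"
  have W: "finite W" "W \<noteq> {}" "card W = a ^ n"
    using a by (auto simp: W_def card_PiE PiE_eq_empty_iff intro!: finite_PiE)
  have "distr M borel (\<lambda>\<omega>. f (\<rho> \<omega>)) = distr (distr M (count_space UNIV) \<rho>) borel f"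
    using meas by (subst distr_distr) (auto simp: comp_def)
  also have "\<dots> = distr (measure_pmf (riffle_shuffle n a)) borel f"
    by (simp only: law)
  finally have "char (distr M borel (\<lambda>\<omega>. f (\<rho> \<omega>))) t
      = (CLINT \<sigma>|measure_pmf (riffle_shuffle n a). iexp (t * f \<sigma>))"
    by (simp add: char_def integral_distr)
  also have "\<dots> = (\<Sum>x\<in>W. iexp (t * f (digit_perm n x)) / of_real (real (a ^ n)))"
    unfolding riffle_shuffle_digits[OF a] integral_map_pmf W_def[symmetric]
    using W by (subst integral_measure_pmf[of W]) (auto simp: scaleR_conv_of_real field_simps)
  finally show ?thesis by (simp add: W_def sum_divide_distrib)
qed

theorem theorem8p2:
  fixes a :: nat
    and M :: "nat \<Rightarrow> 'w measure"
    and \<rho> :: "nat \<Rightarrow> 'w \<Rightarrow> (nat \<Rightarrow> nat)"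
  assumes "a \<ge> 2"
    and "\<And>n. prob_space (M n)"
    and "\<And>n. \<rho> n \<in> measurable (M n) (count_space UNIV)"
    and "\<And>n. distr (M n) (count_space UNIV) (\<rho> n) = measure_pmf (riffle_shuffle n a)"
  shows "weak_conv_m
    (\<lambda>n. distr (M n) borel (\<lambda>\<omega>.
       (real (inversions n (\<rho> n \<omega>)) - real n * (real n - 1) / 4 * ((real a - 1) / real a))
         / (sqrt (real n) * (real n - 1) * sqrt (((real a)\<^sup>2 - 1) / (36 * (real a)\<^sup>2)))))
    std_normal_distribution"
proof -
  have "weak_conv_m (\<lambda>n. distr (M n) borel (\<lambda>\<omega>. standardised_inversions n a (\<rho> n \<omega>)))
    std_normal_distribution"
  proof (rule levy_continuity)
    fix n
    interpret prob_space "M n" by fact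
    have "(\<lambda>\<omega>. standardised_inversions n a (\<rho> n \<omega>)) \<in> borel_measurable (M n)"
      by (rule measurable_compose[OF assms(3)]) simp
    then show "real_distribution (distr (M n) borel (\<lambda>\<omega>. standardised_inversions n a (\<rho> n \<omega>)))"
      by (rule real_distribution_distr)
  next
    show "real_distribution std_normal_distribution"
      by (rule real_dist_normal_dist)
  next
    fix t :: real
    have "a \<ge> 1" using assms(1) by simp
    note char = char_distr_riffle_shuffle[OF this assms(3,4)]
    show "(\<lambda>n. char (distr (M n) borel (\<lambda>\<omega>. standardised_inversions n a (\<rho> n \<omega>))) t)
      \<longlonglongrightarrow> char std_normal_distribution t"
      unfolding char char_std_normal_distribution
      by (rule char_standardised_inversions_tendsto[OF assms(1)])
  qed
  then show ?thesis
    by (simp only: standardised_inversions_def)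
qed

end
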